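(* Let $C$ be a cluster of $k\in\{2,3,4,5\}$ pentachora of $\partial\Delta^5$, and let generic coefficients $\gamma_{ij}\in F$ be given for each ordered pair $(i,j)$, $i\ne j$, of vertices of $C$. For each boundary edge $ij$ of $C$, let $\phi^{\mathrm{boundary}}_{ij}$ be the linear functional on colorings of the boundary tetrahedra of $C$ whose component on a boundary tetrahedron $t\supset ij$ is $\epsilon^{\mathrm{boundary}}_t\, r_t(ij)$, and whose components on boundary tetrahedra not containing $ij$ are zero. Then the colors of inner tetrahedra can be excluded from the linear dependencies defining permitted colorings, in the following sense: for every permitted coloring of $C$, its restriction to the boundary tetrahedra satisfies $$\phi^{\mathrm{boundary}}_{ij}=0\quad\text{for all boundary edges } ij .$$ Moreover, for each boundary vertex $i$, $$\sum_{\text{all boundary edges } ij\ni i}\gamma_{ij}\,\phi^{\mathrm{boundary}}_{ij}=0 .$$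
   Context: $\Delta^5$ is the 5-simplex with vertices $1,\dots,6$. A pentachoron is a 4-simplex and a tetrahedron is a 3-simplex; simplices are written with vertices in increasing order. A cluster is a subcomplex of $\partial\Delta^5$ consisting of some of its six pentachora (with all their faces), as it occurs on a side of a four-dimensional Pachner move. It is oriented consistently, with the orientation inherited from an orientation of $\partial\Delta^5$. A tetrahedron of the cluster is inner if it lies in two pentachora of the cluster and boundary if it lies in exactly one; boundary edges and vertices are those of boundary tetrahedra. Colors: $F$ is a field. A coloring assigns to every tetrahedron $t$ a column $(x_t,y_t)^{\mathrm T}\in F^2$. Edges are unoriented: $ij=ji$; but $\gamma_{ij}$ and $\gamma_{ji}$ are unrelated elements of $F$. "Generic" means that the $\gamma_{ij}$ lie outside the zero set of some suitable nonzero polynomial (they satisfy no accidental algebraic relation); $F$, of any characteristic, is assumed big enough to contain such elements. Rows $r_t(e)\in F^2$ ($e$ an edge of $t$): for $t=1234$, $$r(12)=\bigl(0,\ -\gamma_{13}A\bigr),\quad r(13)=\bigl(\gamma_{14}A,\ \gamma_{12}A\bigr),\quad r(14)=\bigl(-\gamma_{13}A,\ 0\bigr),$$ $$r(23)=\bigl(-\gamma_{24}B,\ \gamma_{13}\gamma_{21}\gamma_{34}\gamma_{42}-\gamma_{12}\gamma_{24}\gamma_{31}\gamma_{43}\bigr),\quad r(24)=\bigl(\gamma_{23}B,\ D\gamma_{43}\bigr),$$ $$r(34)=\bigl(\gamma_{13}\gamma_{24}\gamma_{32}\gamma_{41}-\gamma_{14}\gamma_{23}\gamma_{31}\gamma_{42},\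 -D\gamma_{42}\bigr),$$ where $A=\gamma_{24}\gamma_{32}\gamma_{43}+\gamma_{23}\gamma_{34}\gamma_{42}$, $B=\gamma_{14}\gamma_{31}\gamma_{43}+\gamma_{13}\gamma_{34}\gamma_{41}$, $D=\gamma_{13}\gamma_{21}\gamma_{32}+\gamma_{12}\gamma_{23}\gamma_{31}$. For $t=ijkl$, $i<j<k<l$, substitute $1\mapsto i$, $2\mapsto j$, $3\mapsto k$, $4\mapsto l$. Edge functionals: for an oriented pentachoron $u$ and a tetrahedron $t\subset u$, $\epsilon_t^{(u)}=+1$ if the orientation of $t$ given by the increasing order of its vertices coincides with the one induced from $u$, and $-1$ otherwise. For an edge $ij\subset u$, the edge functional $\phi^{(u)}_{ij}$ on colorings of the five tetrahedra of $u$ is $\phi^{(u)}_{ij}=\sum_{t:\ ij\subset t\subset u}\epsilon_t^{(u)}\,r_t(ij)\,(x_t,y_t)^{\mathrm T}$. A coloring of $u$ is permitted if $\phi^{(u)}_{ij}=0$ for all ten edges of $u$. A coloring of all tetrahedra (inner and boundary) of a cluster is permitted if its restriction to each pentachoron is permitted. For a boundary tetrahedron $t$, $\epsilon^{\mathrm{boundary}}_t=\pm1$ compares the orientation of $t$ given by the increasing order of its vertices with the orientation of $t$ as part of the boundary of the oriented cluster ($+1$ if they coincide, $-1$ otherwise). *)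

theory Defs
  imports Complex_Main "HOL-Library.FuncSet" "HOL-Library.Poly_Mapping"
begin

text \<open>Simplices are identified with their vertex sets.\<close>

definition pentachora :: "nat set set" where
  "pentachora = {u. u \<subseteq> {1..6} \<and> card u = 5}"

definition tetrahedra_of :: "nat set \<Rightarrow> nat set set" where
  "tetrahedra_of u = {t. t \<subseteq> u \<and> card t = 4}"

definition edges_of :: "nat set \<Rightarrow> nat set set" where
  "edges_of s = {e. e \<subseteq> s \<and> card e = 2}"

text \<open>
  An orientation of a simplex is a sign \<open>1\<close> or \<open>-1\<close>, relative to the increasing order of its
  vertices. The face of \<open>v\<^sub>0 < \<dots> < v\<^sub>4\<close> opposite to \<open>v\<^sub>p\<close> gets the induced sign \<open>(-1)\<^sup>p\<close>; hence
  \<open>eps \<sigma> u t\<close> compares the increasing order of \<open>t\<close> with the orientation induced from \<open>u\<close>, where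
  \<open>u\<close> carries the orientation \<open>\<sigma> u\<close>. The opposite convention for the induced orientation
  amounts to replacing \<open>\<sigma>\<close> by \<open>-\<sigma>\<close>.
\<close>

definition eps :: "(nat set \<Rightarrow> int) \<Rightarrow> nat set \<Rightarrow> nat set \<Rightarrow> int" where
  "eps \<sigma> u t = \<sigma> u * (-1) ^ card {w \<in> u. w < the_elem (u - t)}"

text \<open>
  Consistency: the two pentachora sharing a tetrahedron induce opposite orientations on it. Any
  two distinct pentachora of the boundary of the 5-simplex share exactly one tetrahedron.
\<close>

definition orientation :: "(nat set \<Rightarrow> int) \<Rightarrow> bool" where
  "orientation \<sigma> \<longleftrightarrow>
     (\<forall>u\<in>pentachora. \<sigma> u = 1 \<or> \<sigma> u = -1) \<and>
     (\<forall>u\<in>pentachora. \<forall>u'\<in>pentachora. \<forall>t.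
        u \<noteq> u' \<and> t \<in> tetrahedra_of u \<and> t \<in> tetrahedra_of u' \<longrightarrow> eps \<sigma> u t = - eps \<sigma> u' t)"

definition cluster :: "nat set set \<Rightarrow> bool" where
  "cluster C \<longleftrightarrow> C \<subseteq> pentachora \<and> card C \<in> {2, 3, 4, 5}"

definition boundary_tetrahedra :: "nat set set \<Rightarrow> nat set set" where
  "boundary_tetrahedra C = {t. \<exists>!u. u \<in> C \<and> t \<in> tetrahedra_of u}"

definition boundary_edges :: "nat set set \<Rightarrow> nat set set" where
  "boundary_edges C = (\<Union>t\<in>boundary_tetrahedra C. edges_of t)"

definition boundary_vertices :: "nat set set \<Rightarrow> nat set" where
  "boundary_vertices C = \<Union> (boundary_tetrahedra C)"

definition eps_boundary :: "(nat set \<Rightarrow> int) \<Rightarrow> nat set set \<Rightarrow> nat set \<Rightarrow> int" where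
  "eps_boundary \<sigma> C t = eps \<sigma> (THE u. u \<in> C \<and> t \<in> tetrahedra_of u) t"

text \<open>
  The value at an \<open>e\<close> that is not an edge of \<open>t\<close> is never used.
\<close>

definition row :: "(nat \<Rightarrow> nat \<Rightarrow> 'a::field) \<Rightarrow> nat set \<Rightarrow> nat set \<Rightarrow> 'a \<times> 'a" where
  "row \<gamma> t e = (case sorted_list_of_set t of
     [i, j, k, l] \<Rightarrow>
       (let A = \<gamma> j l * \<gamma> k j * \<gamma> l k + \<gamma> j k * \<gamma> k l * \<gamma> l j;
            B = \<gamma> i l * \<gamma> k i * \<gamma> l k + \<gamma> i k * \<gamma> k l * \<gamma> l i;
            D = \<gamma> i k * \<gamma> j i * \<gamma> k j + \<gamma> i j * \<gamma> j k * \<gamma> k i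
        in if e = {i, j} then (0, - \<gamma> i k * A)
           else if e = {i, k} then (\<gamma> i l * A, \<gamma> i j * A)
           else if e = {i, l} then (- \<gamma> i k * A, 0)
           else if e = {j, k} then
             (- \<gamma> j l * B,
              \<gamma> i k * \<gamma> j i * \<gamma> k l * \<gamma> l j - \<gamma> i j * \<gamma> j l * \<gamma> k i * \<gamma> l k)
           else if e = {j, l} then (\<gamma> j k * B, D * \<gamma> l k)
           else if e = {k, l} then
             (\<gamma> i k * \<gamma> j l * \<gamma> k j * \<gamma> l i - \<gamma> i l * \<gamma> j k * \<gamma> k i * \<gamma> l j,
              - D * \<gamma> l j)
           else (0, 0))
   | _ \<Rightarrow> (0, 0))"

definition row_col :: "'a::field \<times> 'a \<Rightarrow> 'a \<times> 'a \<Rightarrow> 'a" where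
  "row_col r x = fst r * fst x + snd r * snd x"

text \<open>Colorings are total functions; only their values at the relevant tetrahedra matter.\<close>

definition edge_functional ::
    "(nat set \<Rightarrow> int) \<Rightarrow> (nat \<Rightarrow> nat \<Rightarrow> 'a::field) \<Rightarrow> nat set \<Rightarrow> nat set
      \<Rightarrow> (nat set \<Rightarrow> 'a \<times> 'a) \<Rightarrow> 'a" where
  "edge_functional \<sigma> \<gamma> u e c =
     (\<Sum>t | t \<in> tetrahedra_of u \<and> e \<subseteq> t. of_int (eps \<sigma> u t) * row_col (row \<gamma> t e) (c t))"

definition permitted ::
    "(nat set \<Rightarrow> int) \<Rightarrow> (nat \<Rightarrow> nat \<Rightarrow> 'a::field) \<Rightarrow> nat set set
      \<Rightarrow> (nat set \<Rightarrow> 'a \<times> 'a) \<Rightarrow> bool" where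
  "permitted \<sigma> \<gamma> C c \<longleftrightarrow> (\<forall>u\<in>C. \<forall>e\<in>edges_of u. edge_functional \<sigma> \<gamma> u e c = 0)"

definition boundary_functional ::
    "(nat set \<Rightarrow> int) \<Rightarrow> (nat \<Rightarrow> nat \<Rightarrow> 'a::field) \<Rightarrow> nat set set \<Rightarrow> nat set
      \<Rightarrow> (nat set \<Rightarrow> 'a \<times> 'a) \<Rightarrow> 'a" where
  "boundary_functional \<sigma> \<gamma> C e c =
     (\<Sum>t | t \<in> boundary_tetrahedra C \<and> e \<subseteq> t.
        of_int (eps_boundary \<sigma> C t) * row_col (row \<gamma> t e) (c t))"

text \<open>
  A multivariate polynomial whose variables are ordered pairs \<open>(i, j)\<close> of vertices is a finitely
  supported map from monomials to coefficients, a monomial being a finitely supported map from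
  variables to exponents.
\<close>

type_synonym 'a gamma_poly = "((nat \<times> nat) \<Rightarrow>\<^sub>0 nat) \<Rightarrow>\<^sub>0 'a"

definition eval_poly :: "'a::field gamma_poly \<Rightarrow> (nat \<Rightarrow> nat \<Rightarrow> 'a) \<Rightarrow> 'a" where
  "eval_poly P \<gamma> =
     (\<Sum>m\<in>Poly_Mapping.keys P. Poly_Mapping.lookup P m *
        (\<Prod>(i, j)\<in>Poly_Mapping.keys m. \<gamma> i j ^ Poly_Mapping.lookup m (i, j)))"

text \<open>
  \<open>Q\<close> holds outside the zero set of some nonzero polynomial in the \<open>\<gamma>\<^sub>i\<^sub>j\<close>, \<open>i \<noteq> j\<close> in \<open>V\<close>.
  The polynomial is required not to vanish at every point, since a nonzero polynomial over
  a finite field may do so, and then the condition on \<open>Q\<close> would be void. Over an infinite field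
  this requirement is automatic.
\<close>

definition holds_generically ::
    "nat set \<Rightarrow> ((nat \<Rightarrow> nat \<Rightarrow> 'a::field) \<Rightarrow> bool) \<Rightarrow> bool" where
  "holds_generically V Q \<longleftrightarrow>
     (\<exists>P :: 'a gamma_poly.
        P \<noteq> 0 \<and>
        (\<forall>m\<in>Poly_Mapping.keys P.
           Poly_Mapping.keys m \<subseteq> {(i, j). i \<in> V \<and> j \<in> V \<and> i \<noteq> j}) \<and>
        (\<exists>\<gamma>. eval_poly P \<gamma> \<noteq> 0) \<and>
        (\<forall>\<gamma>. eval_poly P \<gamma> \<noteq> 0 \<longrightarrow> Q \<gamma>))"

end

theory Submission
  imports Defs
begin

text \<open>
  Both claims are polynomial identities in the coefficients \<open>\<gamma>\<close>, so the constant polynomial \<open>1\<close>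
  serves as the genericity condition.

  Exclusion of the inner colors: a row \<open>r\<^sub>t(e)\<close> depends on the tetrahedron and the edge but not on
  the pentachoron, which enters an edge functional only through the sign \<open>\<epsilon>\<close>. When the edge
  functionals of one edge are added over all pentachora of the cluster, consistency of the
  orientation makes the two contributions of an inner tetrahedron cancel, while a boundary
  tetrahedron contributes once, with its boundary sign. The sum is therefore the boundary functional
  (lemma \<open>boundary_functional_eq_sum_edge_functionals\<close>), and it vanishes as soon as its terms do.

  Relation at a vertex: already within one tetrahedron \<open>t\<close>, the three rows of the edges at a vertex
  \<open>i\<close> satisfy \<open>\<Sum>\<^sub>j \<gamma>\<^sub>i\<^sub>j r\<^sub>t(ij) = 0\<close> (lemma \<open>sum_rows_at_vertex\<close>). Exchanging the sum over the
  edges at \<open>i\<close> with the sum over the boundary tetrahedra splits the relation into these local ones.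
\<close>

section \<open>Cancellation of inner tetrahedra\<close>

lemma finite_tetrahedra_of: "u \<in> pentachora \<Longrightarrow> finite (tetrahedra_of u)"
  by (auto simp: pentachora_def tetrahedra_of_def intro: finite_subset[of _ "Pow u"] finite_subset)

lemma finite_pentachora: "finite pentachora"
  unfolding pentachora_def by (rule finite_subset[of _ "Pow {1..6}"]) auto

lemma boundary_tetrahedra_subset: "boundary_tetrahedra C \<subseteq> (\<Union>u\<in>C. tetrahedra_of u)"
  by (auto simp: boundary_tetrahedra_def)

lemma finite_boundary_tetrahedra:
  assumes "C \<subseteq> pentachora"
  shows "finite (boundary_tetrahedra C)"
proof (rule finite_subset[OF boundary_tetrahedra_subset])
  show "finite (\<Union>u\<in>C. tetrahedra_of u)"
    using assms finite_subset[OF assms finite_pentachora] finite_tetrahedra_of by blast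
qed

lemma eps_opposite:
  assumes "orientation \<sigma>" "u \<in> pentachora" "u' \<in> pentachora" "u \<noteq> u'"
    and "t \<in> tetrahedra_of u" "t \<in> tetrahedra_of u'"
  shows "eps \<sigma> u t = - eps \<sigma> u' t"
  using assms unfolding orientation_def by blast

lemma eps_nonzero:
  assumes "orientation \<sigma>" "u \<in> pentachora"
  shows "eps \<sigma> u t \<noteq> 0"
  using assms unfolding orientation_def eps_def by fastforce

text \<open>
  That a tetrahedron lies in at most two pentachora follows from the signs alone: three nonzero
  integers cannot be pairwise opposite.
\<close>

lemma sum_eps_over_cofaces:
  assumes \<sigma>: "orientation \<sigma>" and C: "C \<subseteq> pentachora"
    and t: "t \<in> (\<Union>u\<in>C. tetrahedra_of u)"
  shows "(\<Sum>u | u \<in> C \<and> t \<in> tetrahedra_of u. eps \<sigma> u t) =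
    (if t \<in> boundary_tetrahedra C then eps_boundary \<sigma> C t else 0)"
proof (cases "t \<in> boundary_tetrahedra C")
  case True
  then obtain u where u: "u \<in> C \<and> t \<in> tetrahedra_of u"
    and uniq: "\<And>u'. u' \<in> C \<and> t \<in> tetrahedra_of u' \<Longrightarrow> u' = u"
    unfolding boundary_tetrahedra_def by auto
  have "{u. u \<in> C \<and> t \<in> tetrahedra_of u} = {u}"
    using u uniq by blast
  moreover have "(THE u. u \<in> C \<and> t \<in> tetrahedra_of u) = u"
    using u uniq by (rule the_equality)
  ultimately show ?thesis
    using True by (simp add: eps_boundary_def)
next
  case False
  obtain u where u: "u \<in> C" "t \<in> tetrahedra_of u"
    using t by blast
  with False obtain u' where u': "u' \<in> C" "t \<in> tetrahedra_of u'" "u' \<noteq> u"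
    unfolding boundary_tetrahedra_def by blast
  have "w = u \<or> w = u'" if w: "w \<in> C" "t \<in> tetrahedra_of w" for w
  proof (rule ccontr)
    assume "\<not> (w = u \<or> w = u')"
    then have "eps \<sigma> w t = - eps \<sigma> u t" "eps \<sigma> w t = - eps \<sigma> u' t" "eps \<sigma> u' t = - eps \<sigma> u t"
      using eps_opposite[OF \<sigma>] u u' w C by blast+
    then show False
      using eps_nonzero[OF \<sigma>, of w t] w C by auto
  qed
  then have "{u. u \<in> C \<and> t \<in> tetrahedra_of u} = {u, u'}"
    using u u' by blast
  moreover have "eps \<sigma> u' t = - eps \<sigma> u t"
    using eps_opposite[OF \<sigma>] u u' C by blast
  ultimately show ?thesis
    using False u' by simp
qed

lemma boundary_functional_eq_sum_edge_functionals:
  fixes \<gamma> :: "nat \<Rightarrow> nat \<Rightarrow> 'a::field"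
  assumes \<sigma>: "orientation \<sigma>" and C: "C \<subseteq> pentachora"
  shows "boundary_functional \<sigma> \<gamma> C e c = (\<Sum>u\<in>C. edge_functional \<sigma> \<gamma> u e c)"
proof -
  define T where "T = (\<Union>u\<in>C. tetrahedra_of u)"
  define x where "x t = row_col (row \<gamma> t e) (c t)" for t
  have fC: "finite C"
    using C finite_pentachora by (rule finite_subset)
  have fT: "finite T"
    unfolding T_def using fC C finite_tetrahedra_of by blast
  have "(\<Sum>u\<in>C. edge_functional \<sigma> \<gamma> u e c) =
      (\<Sum>u\<in>C. \<Sum>t | t \<in> {t \<in> T. e \<subseteq> t} \<and> t \<in> tetrahedra_of u. of_int (eps \<sigma> u t) * x t)"
    unfolding edge_functional_def x_def T_def
    by (intro sum.cong arg_cong2[where f = sum]) auto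
  also have "\<dots> =
      (\<Sum>t\<in>{t \<in> T. e \<subseteq> t}. \<Sum>u | u \<in> C \<and> t \<in> tetrahedra_of u. of_int (eps \<sigma> u t) * x t)"
    using fC fT by (intro sum.swap_restrict) auto
  also have "\<dots> = (\<Sum>t\<in>{t \<in> T. e \<subseteq> t}.
      if t \<in> boundary_tetrahedra C then of_int (eps_boundary \<sigma> C t) * x t else 0)"
  proof (rule sum.cong[OF refl])
    fix t assume "t \<in> {t \<in> T. e \<subseteq> t}"
    then have t: "t \<in> (\<Union>u\<in>C. tetrahedra_of u)"
      by (simp add: T_def)
    have "(\<Sum>u | u \<in> C \<and> t \<in> tetrahedra_of u. of_int (eps \<sigma> u t) * x t) =
        of_int (\<Sum>u | u \<in> C \<and> t \<in> tetrahedra_of u. eps \<sigma> u t) * x t"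
      by (simp add: sum_distrib_right)
    then show "(\<Sum>u | u \<in> C \<and> t \<in> tetrahedra_of u. of_int (eps \<sigma> u t) * x t) =
        (if t \<in> boundary_tetrahedra C then of_int (eps_boundary \<sigma> C t) * x t else 0)"
      using sum_eps_over_cofaces[OF \<sigma> C t] by simp
  qed
  also have "\<dots> = (\<Sum>t\<in>{t \<in> T. e \<subseteq> t} \<inter> boundary_tetrahedra C.
      of_int (eps_boundary \<sigma> C t) * x t)"
    using fT by (subst sum.inter_restrict) auto
  also have "{t \<in> T. e \<subseteq> t} \<inter> boundary_tetrahedra C = {t. t \<in> boundary_tetrahedra C \<and> e \<subseteq> t}"
    using boundary_tetrahedra_subset[of C] unfolding T_def by blast
  finally show ?thesis
    by (simp add: boundary_functional_def x_def)
qed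

lemma boundary_functional_restrict:
  "boundary_functional \<sigma> \<gamma> C e (restrict c (boundary_tetrahedra C)) =
    boundary_functional \<sigma> \<gamma> C e c"
  unfolding boundary_functional_def by (intro sum.cong) auto

text \<open>
  A permitted coloring kills every summand: the pentachora not containing \<open>e\<close> contribute an empty
  sum, the others a defining equation of permittedness.
\<close>

lemma permitted_imp_boundary_functional_zero:
  fixes \<gamma> :: "nat \<Rightarrow> nat \<Rightarrow> 'a::field"
  assumes "orientation \<sigma>" "C \<subseteq> pentachora" "permitted \<sigma> \<gamma> C c" "card e = 2"
  shows "boundary_functional \<sigma> \<gamma> C e c = 0"
proof -
  have "edge_functional \<sigma> \<gamma> u e c = 0" if "u \<in> C" for u
  proof (cases "e \<subseteq> u")
    case True
    then show ?thesis
      using assms that by (auto simp: permitted_def edges_of_def)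
  next
    case False
    then have none: "{t. t \<in> tetrahedra_of u \<and> e \<subseteq> t} = {}"
      by (auto simp: tetrahedra_of_def)
    show ?thesis
      unfolding edge_functional_def none by simp
  qed
  then show ?thesis
    using assms by (simp add: boundary_functional_eq_sum_edge_functionals)
qed

section \<open>The relation at a vertex\<close>

lemma card_4_sorted:
  fixes t :: "nat set"
  assumes "card t = 4"
  obtains i j k l where "t = {i, j, k, l}" "i < j" "j < k" "k < l"
proof -
  define xs where "xs = sorted_list_of_set t"
  have fin: "finite t"
    using assms card.infinite by fastforce
  have xs: "length xs = 4" "set xs = t" "sorted_wrt (<) xs"
    using assms fin by (simp_all add: xs_def strict_sorted_list_of_set)
  then obtain i j k l where "xs = [i, j, k, l]"
    by (auto simp: numeral_eq_Suc length_Suc_conv)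
  then show ?thesis
    using xs that by auto
qed

text \<open>
  The cubic factors are tuned for this identity. At the smallest vertex the terms cancel in pairs
  with \<open>A\<close> as a common factor; at each other vertex some component of the sum cancels only after
  \<open>A\<close>, \<open>B\<close> or \<open>D\<close> are expanded into monomials.
\<close>

lemma sum_rows_at_vertex:
  fixes \<gamma> :: "nat \<Rightarrow> nat \<Rightarrow> 'a::field"
  assumes "card t = 4" "v \<in> t"
  shows "(\<Sum>w\<in>t - {v}. \<gamma> v w * row_col (row \<gamma> t {v, w}) x) = 0"
proof -
  obtain i j k l where t: "t = {i, j, k, l}" and less: "i < j" "j < k" "k < l"
    using card_4_sorted[OF assms(1)] .
  have sorted: "sorted_list_of_set t = [i, j, k, l]"
    using less sorted_list_of_set.idem_if_sorted_distinct[of "[i, j, k, l]"] by (simp add: t)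
  have ne: "i \<noteq> j" "i \<noteq> k" "i \<noteq> l" "j \<noteq> k" "j \<noteq> l" "k \<noteq> l"
    using less by auto
  note [simp] = ne ne[symmetric]
  consider "v = i" | "v = j" | "v = k" | "v = l"
    using assms(2) t by auto
  then show ?thesis
  proof cases
    case 1
    then have "t - {v} = {j, k, l}" using t ne by auto
    with 1 show ?thesis
      by (simp add: row_def sorted row_col_def Let_def doubleton_eq_iff algebra_simps)
  next
    case 2
    then have "t - {v} = {i, k, l}" using t ne by auto
    with 2 show ?thesis
      by (simp add: row_def sorted row_col_def Let_def doubleton_eq_iff algebra_simps)
  next
    case 3
    then have "t - {v} = {i, j, l}" using t ne by auto
    with 3 show ?thesis
      by (simp add: row_def sorted row_col_def Let_def doubleton_eq_iff algebra_simps)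
  next
    case 4
    then have "t - {v} = {i, j, k}" using t ne by auto
    with 4 show ?thesis
      by (simp add: row_def sorted row_col_def Let_def doubleton_eq_iff algebra_simps)
  qed
qed

lemma sum_boundary_functionals_at_vertex:
  fixes \<gamma> :: "nat \<Rightarrow> nat \<Rightarrow> 'a::field"
  assumes C: "C \<subseteq> pentachora"
  shows "(\<Sum>j | {i, j} \<in> boundary_edges C. \<gamma> i j * boundary_functional \<sigma> \<gamma> C {i, j} b) = 0"
proof -
  define T where "T = boundary_tetrahedra C"
  define J where "J = {j. {i, j} \<in> boundary_edges C}"
  define f where "f j t = of_int (eps_boundary \<sigma> C t) * (\<gamma> i j * row_col (row \<gamma> t {i, j}) (b t))"
    for j t
  have fT: "finite T"
    unfolding T_def using C by (rule finite_boundary_tetrahedra)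
  have card_T: "card t = 4" if "t \<in> T" for t
    using that boundary_tetrahedra_subset[of C] by (auto simp: T_def tetrahedra_of_def)
  have "J \<subseteq> \<Union>T"
    by (auto simp: J_def T_def boundary_edges_def edges_of_def)
  moreover have "finite (\<Union>T)"
    using fT card_T by (metis card.infinite finite_Union zero_neq_numeral)
  ultimately have fJ: "finite J"
    by (rule finite_subset)
  have "(\<Sum>j\<in>J. \<gamma> i j * boundary_functional \<sigma> \<gamma> C {i, j} b) =
      (\<Sum>j\<in>J. \<Sum>t | t \<in> T \<and> {i, j} \<subseteq> t. f j t)"
    by (simp add: boundary_functional_def T_def f_def sum_distrib_left mult.left_commute)
  also have "\<dots> = (\<Sum>t\<in>T. \<Sum>j | j \<in> J \<and> {i, j} \<subseteq> t. f j t)"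
    using fJ fT by (rule sum.swap_restrict)
  also have "\<dots> = 0"
  proof (rule sum.neutral, rule ballI)
    fix t assume t: "t \<in> T"
    show "(\<Sum>j | j \<in> J \<and> {i, j} \<subseteq> t. f j t) = 0"
    proof (cases "i \<in> t")
      case True
      have "{j. j \<in> J \<and> {i, j} \<subseteq> t} = t - {i}"
        using t True
        by (auto simp: J_def T_def boundary_edges_def edges_of_def card_2_iff doubleton_eq_iff)
      then show ?thesis
        using sum_rows_at_vertex[OF card_T[OF t] True, of \<gamma> "b t"]
        by (simp add: f_def flip: sum_distrib_left)
    next
      case False
      then show ?thesis
        by simp
    qed
  qed
  finally show ?thesis
    by (simp add: J_def)
qed

section \<open>Genericity\<close>

lemma holds_generically_if_always:
  assumes "\<And>\<gamma> :: nat \<Rightarrow> nat \<Rightarrow> 'a::field. Q \<gamma>"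
  shows "holds_generically V Q"
  unfolding holds_generically_def
  by (rule exI[of _ 1]) (use assms in \<open>auto simp: eval_poly_def\<close>)

theorem theorem1:
  fixes C :: "nat set set" and \<sigma> :: "nat set \<Rightarrow> int"
  assumes "cluster C" and "orientation \<sigma>"
  shows "holds_generically (\<Union>C) (\<lambda>\<gamma> :: nat \<Rightarrow> nat \<Rightarrow> 'a::field.
           (\<forall>c :: nat set \<Rightarrow> 'a \<times> 'a. permitted \<sigma> \<gamma> C c \<longrightarrow>
              (\<forall>e\<in>boundary_edges C.
                 boundary_functional \<sigma> \<gamma> C e (restrict c (boundary_tetrahedra C)) = 0)) \<and>
           (\<forall>i\<in>boundary_vertices C. \<forall>b :: nat set \<Rightarrow> 'a \<times> 'a.
              (\<Sum>j | {i, j} \<in> boundary_edges C. \<gamma> i j * boundary_functional \<sigma> \<gamma> C {i, j} b) = 0))"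
proof (rule holds_generically_if_always, intro conjI allI impI ballI)
  have C: "C \<subseteq> pentachora"
    using assms(1) by (simp add: cluster_def)
  {
    fix \<gamma> :: "nat \<Rightarrow> nat \<Rightarrow> 'a" and c :: "nat set \<Rightarrow> 'a \<times> 'a" and e
    assume perm: "permitted \<sigma> \<gamma> C c" and "e \<in> boundary_edges C"
    then have "card e = 2"
      by (auto simp: boundary_edges_def edges_of_def)
    with perm show "boundary_functional \<sigma> \<gamma> C e (restrict c (boundary_tetrahedra C)) = 0"
      using permitted_imp_boundary_functional_zero[OF assms(2) C]
      by (simp add: boundary_functional_restrict)
  }
  fix \<gamma> :: "nat \<Rightarrow> nat \<Rightarrow> 'a" and i and b :: "nat set \<Rightarrow> 'a \<times> 'a"
  show "(\<Sum>j | {i, j} \<in> boundary_edges C. \<gamma> i j * boundary_functional \<sigma> \<gamma> C {i, j} b) = 0"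
    using C by (rule sum_boundary_functionals_at_vertex)
qed

end
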